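(* The range of every approximable function is the range of some function which is $2$-approximable from above. Indeed, the ranges of the total functions $\omega\to\omega$ that are $2$-approximable from above are precisely the nonempty $\Sigma^0_2$ subsets of $\omega$.
   Context: A total $f:\omega\to\omega$ is approximable if $f(x)=\lim_s g(x,s)$ for some total computable $g:\omega^2\to\omega$. It is $2$-approximable from above if there is such a $g$ with $g(x,s+1)\le g(x,s)$ for all $x,s$ and $|\{s:g(x,s)\ne g(x,s+1)\}|\le 2$ for all $x$. *)

theory Defs
  imports Complex_Main
begin

(* Kleene's partial recursive functions. Arities are not recorded in the
   syntax: a program denotes one partial function for each length of the
   argument list. Primitive recursion is on the first argument, and the step
   program of Prec receives (previous value, counter, parameters). *)

datatype recf =
    Zero
  | Succ
  | Proj nat
  | Comp recf "recf list"
  | Prec recf recf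
  | Mu recf

fun eval :: "recf \<Rightarrow> nat list \<Rightarrow> nat option" where
  "eval Zero xs = Some 0"
| "eval Succ xs = (case xs of [x] \<Rightarrow> Some (Suc x) | _ \<Rightarrow> None)"
| "eval (Proj i) xs = (if i < length xs then Some (xs ! i) else None)"
| "eval (Comp f gs) xs =
    (if \<forall>g \<in> set gs. eval g xs \<noteq> None
     then eval f (map (\<lambda>g. the (eval g xs)) gs) else None)"
| "eval (Prec f g) xs =
    (case xs of
       [] \<Rightarrow> None
     | n # ys \<Rightarrow>
         rec_nat (eval f ys)
           (\<lambda>k r. case r of None \<Rightarrow> None | Some v \<Rightarrow> eval g (v # k # ys)) n)"
| "eval (Mu f) xs =
    (if \<exists>n. eval f (n # xs) = Some 0 \<and> (\<forall>i<n. eval f (i # xs) \<noteq> None)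
     then Some (LEAST n. eval f (n # xs) = Some 0) else None)"

definition computable2 :: "(nat \<Rightarrow> nat \<Rightarrow> nat) \<Rightarrow> bool" where
  "computable2 g \<longleftrightarrow> (\<exists>e. \<forall>x s. eval e [x, s] = Some (g x s))"

definition computable_rel3 :: "(nat \<Rightarrow> nat \<Rightarrow> nat \<Rightarrow> bool) \<Rightarrow> bool" where
  "computable_rel3 R \<longleftrightarrow>
     (\<exists>e. \<forall>x y z. eval e [x, y, z] = Some (if R x y z then 1 else 0))"

definition Sigma02 :: "nat set \<Rightarrow> bool" where
  "Sigma02 A \<longleftrightarrow> (\<exists>R. computable_rel3 R \<and> A = {x. \<exists>y. \<forall>z. R x y z})"

(* The topology on nat is discrete, so this limit is eventual constancy. *)

definition approximates :: "(nat \<Rightarrow> nat \<Rightarrow> nat) \<Rightarrow> (nat \<Rightarrow> nat) \<Rightarrow> bool" where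
  "approximates g f \<longleftrightarrow> computable2 g \<and> (\<forall>x. (\<lambda>s. g x s) \<longlonglongrightarrow> f x)"

definition approximable :: "(nat \<Rightarrow> nat) \<Rightarrow> bool" where
  "approximable f \<longleftrightarrow> (\<exists>g. approximates g f)"

definition approximable_from_above :: "nat \<Rightarrow> (nat \<Rightarrow> nat) \<Rightarrow> bool" where
  "approximable_from_above n f \<longleftrightarrow>
     (\<exists>g. approximates g f \<and>
          (\<forall>x s. g x (s + 1) \<le> g x s) \<and>
          (\<forall>x. finite {s. g x s \<noteq> g x (s + 1)} \<and>
               card {s. g x s \<noteq> g x (s + 1)} \<le> n))"

end

theory Submission
  imports Defs
begin

(* If f is the limit of g then y is in the range of f iff g(x,s) = y for some x and all large s,
   which is a Sigma-2 condition. Conversely, let A be a nonempty set of the form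
   {x. EX y. ALL z. R x y z} and let a be its least element. Guess x at the argument coding (x,y),
   and fall back to a once some z refutes R x y z. Numbers below a are not in A, so they may be
   replaced by a from the beginning; then the only possible change is a decrease from x to a. *)

section \<open>Computable functions of fixed arity\<close>

text \<open>Programs carry no arity, so \<open>k\<close> fixes the argument length and leaves other
  lists unconstrained. Only total functions are treated, so closure lemmas need no definedness
  conditions.\<close>

definition computes :: "nat \<Rightarrow> (nat list \<Rightarrow> nat) \<Rightarrow> bool" where
  "computes k F \<longleftrightarrow> (\<exists>e. \<forall>xs. length xs = k \<longrightarrow> eval e xs = Some (F xs))"

section \<open>Closure under composition, primitive recursion and minimization\<close>

lemma computes_proj: "i < k \<Longrightarrow> computes k (\<lambda>xs. xs ! i)"
  unfolding computes_def by (rule exI[of _ "Proj i"]) auto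

lemma computes_comp:
  assumes "computes (length Fs) G" and "\<forall>F \<in> set Fs. computes k F"
  shows "computes k (\<lambda>xs. G (map (\<lambda>F. F xs) Fs))"
proof -
  obtain e where e: "\<And>xs. length xs = length Fs \<Longrightarrow> eval e xs = Some (G xs)"
    using assms(1) unfolding computes_def by blast
  obtain c where c: "\<And>F xs. F \<in> set Fs \<Longrightarrow> length xs = k \<Longrightarrow> eval (c F) xs = Some (F xs)"
    using bchoice[OF assms(2)[unfolded computes_def]] by blast
  have "eval (Comp e (map c Fs)) xs = Some (G (map (\<lambda>F. F xs) Fs))" if "length xs = k" for xs
  proof -
    have "map (\<lambda>g. the (eval g xs)) (map c Fs) = map (\<lambda>F. F xs) Fs"
      using c that by simp
    then show ?thesis
      using c that e[of "map (\<lambda>F. F xs) Fs"] by (simp del: map_map)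
  qed
  then show ?thesis
    unfolding computes_def by blast
qed

lemma computes_comp1:
  assumes "computes 1 (\<lambda>xs. h (xs ! 0))" and "computes k F"
  shows "computes k (\<lambda>xs. h (F xs))"
  using computes_comp[of "[F]" "\<lambda>xs. h (xs ! 0)" k] assms by simp

lemma computes_comp2:
  assumes "computes 2 (\<lambda>xs. h (xs ! 0) (xs ! 1))" and "computes k F" and "computes k G"
  shows "computes k (\<lambda>xs. h (F xs) (G xs))"
  using computes_comp[of "[F, G]" "\<lambda>xs. h (xs ! 0) (xs ! 1)" k] assms
  by (simp add: numeral_2_eq_2)

lemma computes_comp3:
  assumes "computes 3 (\<lambda>xs. h (xs ! 0) (xs ! 1) (xs ! 2))"
    and "computes k F" and "computes k G" and "computes k H"
  shows "computes k (\<lambda>xs. h (F xs) (G xs) (H xs))"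
  using computes_comp[of "[F, G, H]" "\<lambda>xs. h (xs ! 0) (xs ! 1) (xs ! 2)" k] assms
  by (simp add: numeral_3_eq_3 numeral_2_eq_2)

lemma computes_Suc: "computes k F \<Longrightarrow> computes k (\<lambda>xs. Suc (F xs))"
proof (rule computes_comp1[where h = Suc])
  show "computes 1 (\<lambda>xs. Suc (xs ! 0))"
    unfolding computes_def
    by (rule exI[of _ Succ]) (auto simp: length_Suc_conv)
qed

lemma computes_const: "computes k (\<lambda>_. c)"
proof (induction c)
  case 0
  show ?case
    unfolding computes_def by (rule exI[of _ Zero]) simp
qed (rule computes_Suc)

text \<open>Since both programs are total on the relevant lengths, the recursion of
  \<open>eval\<close> never meets \<open>None\<close> and collapses to \<open>rec_nat\<close> on
  numbers.\<close>

lemma computes_prec: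
  assumes "computes k F" and "computes (Suc (Suc k)) G"
  shows "computes (Suc k) (\<lambda>xs. rec_nat (F (tl xs)) (\<lambda>i v. G (v # i # tl xs)) (xs ! 0))"
proof -
  obtain e where e: "\<And>xs. length xs = k \<Longrightarrow> eval e xs = Some (F xs)"
    using assms(1) unfolding computes_def by blast
  obtain d where d: "\<And>xs. length xs = Suc (Suc k) \<Longrightarrow> eval d xs = Some (G xs)"
    using assms(2) unfolding computes_def by blast
  have step: "rec_nat (eval e ys)
      (\<lambda>i r. case r of None \<Rightarrow> None | Some v \<Rightarrow> eval d (v # i # ys)) n
    = Some (rec_nat (F ys) (\<lambda>i v. G (v # i # ys)) n)" if "length ys = k" for n ys
    by (induction n) (use that e d in auto)
  have "eval (Prec e d) xs = Some (rec_nat (F (tl xs)) (\<lambda>i v. G (v # i # tl xs)) (xs ! 0))"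
    if "length xs = Suc k" for xs
    using that step by (cases xs) auto
  then show ?thesis
    unfolding computes_def by blast
qed

lemma computes_Least:
  assumes "computes (Suc k) P" and ex: "\<And>xs. length xs = k \<Longrightarrow> \<exists>n. P (n # xs) = 0"
  shows "computes k (\<lambda>xs. LEAST n. P (n # xs) = 0)"
proof -
  obtain e where e: "\<And>xs. length xs = Suc k \<Longrightarrow> eval e xs = Some (P xs)"
    using assms(1) unfolding computes_def by blast
  have "eval (Mu e) xs = Some (LEAST n. P (n # xs) = 0)" if "length xs = k" for xs
    using that e ex by simp
  then show ?thesis
    unfolding computes_def by blast
qed

section \<open>Truncated arithmetic and bounded sums\<close>

lemma computes_add:
  assumes "computes k F" and "computes k G"
  shows "computes k (\<lambda>xs. F xs + G xs)"
proof -
  have "computes (Suc 1) (\<lambda>xs. rec_nat (tl xs ! 0) (\<lambda>i v. Suc ((v # i # tl xs) ! 0)) (xs ! 0))"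
    by (rule computes_prec[where G = "\<lambda>xs. Suc (xs ! 0)"])
      (auto intro: computes_Suc computes_proj)
  moreover have "rec_nat m (\<lambda>i v. Suc v) n = n + m" for m n :: nat
    by (induction n) auto
  ultimately have "computes 2 (\<lambda>xs. xs ! 0 + tl xs ! 0)"
    by (simp add: numeral_2_eq_2)
  \<comment> \<open>\<open>tl xs ! 0\<close> and \<open>xs ! 1\<close> agree on lists of length 2,
    the only ones that \<open>computes 2\<close> inspects.\<close>
  then have "computes 2 (\<lambda>xs. xs ! 0 + xs ! 1)"
    by (auto simp: computes_def nth_tl)
  from computes_comp2[OF this assms] show ?thesis .
qed

lemma computes_mult:
  assumes "computes k F" and "computes k G"
  shows "computes k (\<lambda>xs. F xs * G xs)"
proof -
  have "computes (Suc 1)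
      (\<lambda>xs. rec_nat 0 (\<lambda>i v. (v # i # tl xs) ! 0 + (v # i # tl xs) ! 2) (xs ! 0))"
    by (rule computes_prec[where G = "\<lambda>xs. xs ! 0 + xs ! 2"])
      (auto intro!: computes_const computes_add computes_proj)
  moreover have "rec_nat 0 (\<lambda>i v. v + m) n = n * m" for m n :: nat
    by (induction n) auto
  ultimately have "computes 2 (\<lambda>xs. xs ! 0 * tl xs ! 0)"
    by (simp add: numeral_2_eq_2)
  then have "computes 2 (\<lambda>xs. xs ! 0 * xs ! 1)"
    by (auto simp: computes_def nth_tl)
  from computes_comp2[OF this assms] show ?thesis .
qed

lemma computes_pred:
  assumes "computes k F"
  shows "computes k (\<lambda>xs. F xs - 1)"
proof -
  have "computes (Suc 0) (\<lambda>xs. rec_nat 0 (\<lambda>i v. (v # i # tl xs) ! 1) (xs ! 0))"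
    by (rule computes_prec[where G = "\<lambda>xs. xs ! 1"])
      (auto intro: computes_const computes_proj)
  moreover have "rec_nat 0 (\<lambda>i v. i) n = n - 1" for n :: nat
    by (cases n) auto
  ultimately have "computes 1 (\<lambda>xs. xs ! 0 - 1)"
    by simp
  from computes_comp1[OF this assms] show ?thesis .
qed

lemma computes_diff:
  assumes "computes k F" and "computes k G"
  shows "computes k (\<lambda>xs. F xs - G xs)"
proof -
  \<comment> \<open>Recursion runs on the first argument, which must be the subtrahend; the swapped
    order is undone by \<open>assms(2,1)\<close> at the end.\<close>
  have "computes (Suc 1) (\<lambda>xs. rec_nat (tl xs ! 0) (\<lambda>i v. (v # i # tl xs) ! 0 - 1) (xs ! 0))"
    by (rule computes_prec[where G = "\<lambda>xs. xs ! 0 - 1"])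
      (auto intro: computes_pred[simplified] computes_proj)
  moreover have "rec_nat m (\<lambda>i v. v - 1) n = m - n" for m n :: nat
    by (induction n) auto
  ultimately have "computes 2 (\<lambda>xs. tl xs ! 0 - xs ! 0)"
    by (simp add: numeral_2_eq_2)
  then have "computes 2 (\<lambda>xs. xs ! 1 - xs ! 0)"
    by (auto simp: computes_def nth_tl)
  from computes_comp2[OF this assms(2,1)] show ?thesis .
qed

text \<open>For a 0/1-valued \<open>F\<close> the sum counts the \<open>z\<close> below the bound
  with value 1, which turns a bounded search into arithmetic.\<close>

lemma computes_sum:
  assumes "computes (Suc k) F"
  shows "computes (Suc k) (\<lambda>xs. \<Sum>z<xs ! 0. F (z # tl xs))"
proof -
  \<comment> \<open>The list of projections drops the accumulator at the head, so that
    \<open>F\<close> receives the counter and the parameters.\<close>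
  let ?G = "\<lambda>xs. xs ! 0 + F (map (\<lambda>i. xs ! Suc i) [0..<Suc k])"
  have "computes (Suc (Suc k)) (\<lambda>xs. F (map (\<lambda>P. P xs) (map (\<lambda>i xs. xs ! Suc i) [0..<Suc k])))"
    by (rule computes_comp) (use assms in \<open>auto intro: computes_proj\<close>)
  then have "computes (Suc (Suc k)) ?G"
    by (auto intro!: computes_add computes_proj simp: o_def simp del: upt_Suc)
  from computes_prec[OF computes_const[of k 0] this]
  obtain e where e: "\<And>xs. length xs = Suc k \<Longrightarrow>
      eval e xs = Some (rec_nat 0 (\<lambda>i v. ?G (v # i # tl xs)) (xs ! 0))"
    unfolding computes_def by blast
  have "rec_nat 0 (\<lambda>i v. ?G (v # i # ys)) n = (\<Sum>z<n. F (z # ys))" if "length ys = k" for ys n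
  proof (induction n)
    case (Suc n)
    have "map (\<lambda>i. (v # n # ys) ! Suc i) [0..<Suc k] = n # ys" for v
      using map_nth[of "n # ys"] that by simp
    then show ?case
      using Suc by (simp del: upt_Suc)
  qed simp
  then have "eval e xs = Some (\<Sum>z<xs ! 0. F (z # tl xs))" if "length xs = Suc k" for xs
    using e that by simp
  then show ?thesis
    unfolding computes_def by blast
qed

lemmas computes_intros =
  computes_proj computes_const computes_Suc computes_add computes_mult computes_diff

section \<open>Translation between curried computability and \<open>computes\<close>\<close>

lemma computable2_iff_computes:
  "computable2 g \<longleftrightarrow> computes 2 (\<lambda>xs. g (xs ! 0) (xs ! 1))"
  (is "_ \<longleftrightarrow> computes 2 ?F")
proof -
  have "(\<forall>x y. eval e [x, y] = Some (g x y)) \<longleftrightarrow>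
      (\<forall>xs. length xs = 2 \<longrightarrow> eval e xs = Some (?F xs))" for e
    by (auto simp: numeral_2_eq_2 length_Suc_conv)
  then show ?thesis
    unfolding computable2_def computes_def by simp
qed

lemma computable_rel3_iff_computes:
  "computable_rel3 R \<longleftrightarrow> computes 3 (\<lambda>xs. if R (xs ! 0) (xs ! 1) (xs ! 2) then 1 else 0)"
  (is "_ \<longleftrightarrow> computes 3 ?F")
proof -
  have "(\<forall>x y z. eval e [x, y, z] = Some (if R x y z then 1 else 0)) \<longleftrightarrow>
      (\<forall>xs. length xs = 3 \<longrightarrow> eval e xs = Some (?F xs))" for e
    by (auto simp: numeral_3_eq_3 numeral_2_eq_2 length_Suc_conv)
  then show ?thesis
    unfolding computable_rel3_def computes_def by simp
qed

section \<open>A computable enumeration of pairs\<close>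

(* The pair (x, y) is coded by (x + y)^2 + x, whose integer square root is x + y. *)

definition pair_sum :: "nat \<Rightarrow> nat" where
  "pair_sum n = (LEAST k. Suc n - Suc k * Suc k = 0)"

definition pair_fst :: "nat \<Rightarrow> nat" where
  "pair_fst n = n - pair_sum n * pair_sum n"

definition pair_snd :: "nat \<Rightarrow> nat" where
  "pair_snd n = pair_sum n - pair_fst n"

text \<open>The truncated difference vanishes iff the code is below \<open>Suc k * Suc k\<close>. As
  \<open>x\<close> is at most \<open>x + y\<close>, the code lies between the squares of
  \<open>x + y\<close> and of its successor.\<close>

lemma pair_sum_code: "pair_sum ((x + y) * (x + y) + x) = x + y"
  unfolding pair_sum_def
proof (rule Least_equality)
  fix k
  assume k: "Suc ((x + y) * (x + y) + x) - Suc k * Suc k = 0"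
  show "x + y \<le> k"
  proof (rule ccontr)
    assume "\<not> x + y \<le> k"
    then have "Suc k * Suc k \<le> (x + y) * (x + y)"
      by (intro mult_le_mono) auto
    with k show False by simp
  qed
qed simp

text \<open>Every pair is decoded from some number. Repetitions are harmless, as only ranges and
  existential quantifiers over codes are at stake.\<close>

lemma pair_surj: obtains n where "pair_fst n = x" and "pair_snd n = y"
proof
  show "pair_fst ((x + y) * (x + y) + x) = x"
    by (simp add: pair_fst_def pair_sum_code)
  then show "pair_snd ((x + y) * (x + y) + x) = y"
    by (simp add: pair_snd_def pair_sum_code)
qed

lemma computes_pair_sum: "computes k F \<Longrightarrow> computes k (\<lambda>xs. pair_sum (F xs))"
proof (rule computes_comp1[where h = pair_sum])
  have "computes 1 (\<lambda>xs. LEAST k. Suc ((k # xs) ! 1) - Suc ((k # xs) ! 0) * Suc ((k # xs) ! 0) = 0)"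
  proof (rule computes_Least[where P = "\<lambda>xs. Suc (xs ! 1) - Suc (xs ! 0) * Suc (xs ! 0)"])
    show "computes (Suc 1) (\<lambda>xs. Suc (xs ! 1) - Suc (xs ! 0) * Suc (xs ! 0))"
      by (intro computes_intros) auto
    show "\<exists>n. Suc ((n # xs) ! 1) - Suc ((n # xs) ! 0) * Suc ((n # xs) ! 0) = 0" for xs
      \<comment> \<open>The square root of a number is at most that number, so the search
        terminates.\<close>
      by (rule exI[of _ "xs ! 0"]) simp
  qed
  then show "computes 1 (\<lambda>xs. pair_sum (xs ! 0))"
    by (simp add: pair_sum_def)
qed

lemma computes_pair_fst: "computes k F \<Longrightarrow> computes k (\<lambda>xs. pair_fst (F xs))"
  unfolding pair_fst_def by (intro computes_intros computes_pair_sum)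

lemma computes_pair_snd: "computes k F \<Longrightarrow> computes k (\<lambda>xs. pair_snd (F xs))"
  unfolding pair_snd_def by (intro computes_intros computes_pair_sum computes_pair_fst)

section \<open>Ranges of approximable functions\<close>

text \<open>The two existential quantifiers, over the argument and over the stage from which the
  guess is constant, merge into one through pairing.\<close>

lemma Sigma02_range:
  assumes "approximable f"
  shows "Sigma02 (range f)"
proof -
  obtain g where g: "computable2 g" and lim: "\<And>x. (\<lambda>s. g x s) \<longlonglongrightarrow> f x"
    using assms unfolding approximable_def approximates_def by blast
  let ?v = "\<lambda>p s. g (pair_fst p) (pair_snd p + s)"
  let ?R = "\<lambda>y p s. ?v p s = y"
  \<comment> \<open>Two numbers are equal iff both truncated differences vanish, so this is the
    characteristic function of equality.\<close>
  have "computes 3 (\<lambda>xs. 1 - ((?v (xs ! 1) (xs ! 2) - xs ! 0) + (xs ! 0 - ?v (xs ! 1) (xs ! 2))))"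
    by (intro computes_intros computes_comp2[OF g[unfolded computable2_iff_computes]]
        computes_pair_fst computes_pair_snd) auto
  moreover have "1 - ((a - b) + (b - a)) = (if a = b then 1 else 0)" for a b :: nat
    by auto
  ultimately have R: "computable_rel3 ?R"
    unfolding computable_rel3_iff_computes by simp
  have lim_iff: "f x = y \<longleftrightarrow> (\<exists>t. \<forall>s. g x (t + s) = y)" for x y
  proof -
    have "\<forall>\<^sub>F s in sequentially. g x s = f x"
      using lim[of x] by (rule tendsto_discrete[THEN iffD1])
    then obtain N where N: "\<And>s. s \<ge> N \<Longrightarrow> g x s = f x"
      unfolding eventually_sequentially by blast
    show ?thesis
    proof
      show "\<exists>t. \<forall>s. g x (t + s) = y" if "f x = y"
        using N that by (intro exI[of _ N]) simp
      show "f x = y" if "\<exists>t. \<forall>s. g x (t + s) = y"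
        \<comment> \<open>At stage \<open>t + N\<close> the value is both \<open>y\<close> and the
          limit \<open>f x\<close>.\<close>
        using that N by (metis le_add1 add.commute)
    qed
  qed
  have "range f = {y. \<exists>p. \<forall>s. ?R y p s}"
  proof (intro equalityI subsetI CollectI)
    fix y
    assume "y \<in> range f"
    then obtain x t where "\<forall>s. g x (t + s) = y"
      using lim_iff by blast
    moreover obtain p where "pair_fst p = x" and "pair_snd p = t"
      by (rule pair_surj)
    ultimately show "\<exists>p. \<forall>s. ?R y p s"
      by blast
  next
    fix y
    assume "y \<in> {y. \<exists>p. \<forall>s. ?R y p s}"
    then obtain p where "\<forall>s. ?R y p s"
      by blast
    then have "f (pair_fst p) = y"
      using lim_iff by blast
    then show "y \<in> range f"
      by blast
  qed
  then show ?thesis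
    unfolding Sigma02_def using R by blast
qed

text \<open>The construction changes its guess at most once, which gives the bound 1 instead of
  2.\<close>

lemma Sigma02_is_range:
  assumes "Sigma02 A" and "A \<noteq> {}"
  obtains h where "approximable_from_above 1 h" and "range h = A"
proof -
  obtain R where R: "computable_rel3 R" and A: "A = {x. \<exists>y. \<forall>z. R x y z}"
    using assms(1) unfolding Sigma02_def by blast
  define a where "a = (LEAST x. x \<in> A)"
  have a: "a \<in> A"
    unfolding a_def using assms(2) by (auto intro: LeastI)
  have a_least: "a \<le> x" if "x \<in> A" for x
    unfolding a_def using that by (rule Least_le)
  \<comment> \<open>The number \<open>n\<close> codes the guess that \<open>pair_snd n\<close>
    witnesses \<open>pair_fst n\<close> in \<open>A\<close>; a bad \<open>z\<close> refutes
    it.\<close>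
  define bad where "bad = (\<lambda>n z. \<not> R (pair_fst n) (pair_snd n) z)"
  (* Truncated subtraction turns first coordinates below a into a. *)
  define g where "g = (\<lambda>n s. if \<exists>z<s. bad n z then a else a + (pair_fst n - a))"
  define h where "h = (\<lambda>n. if \<exists>z. bad n z then a else a + (pair_fst n - a))"
  let ?F = "\<lambda>xs. 1 - (if R (pair_fst (xs ! 1)) (pair_snd (xs ! 1)) (xs ! 0) then 1 else 0) :: nat"
  \<comment> \<open>This counts the refutations found before stage \<open>s\<close>, so
    \<open>1 - ?S n s\<close> is 1 while there is none and 0 afterwards.\<close>
  let ?S = "\<lambda>n s. \<Sum>z<s. if bad n z then 1 else 0 :: nat"
  have "computes (Suc 1) ?F"
    by (intro computes_intros computes_pair_fst computes_pair_snd
        computes_comp3[where h = "\<lambda>x y z. if R x y z then 1 else 0",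
          OF R[unfolded computable_rel3_iff_computes]]) auto
  moreover have "?F (z # tl xs) = (if bad (tl xs ! 0) z then 1 else 0)" for z xs
    by (simp add: bad_def)
  ultimately have "computes 2 (\<lambda>xs. \<Sum>z<xs ! 0. if bad (tl xs ! 0) z then 1 else 0)"
    using computes_sum[of 1 ?F] by (simp only: numeral_2_eq_2 One_nat_def)
  then have "computes 2 (\<lambda>xs. ?S (xs ! 1) (xs ! 0))"
    by (auto simp: computes_def nth_tl)
  \<comment> \<open>The bounded sum has its bound first; the exchanged projections put the argument
    before the stage.\<close>
  from computes_comp2[OF this computes_proj[of 1 2] computes_proj[of 0 2]]
  have "computes 2 (\<lambda>xs. a + (pair_fst (xs ! 0) - a) * (1 - ?S (xs ! 0) (xs ! 1)))"
    by (intro computes_intros computes_pair_fst) auto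
  moreover have "a + (pair_fst n - a) * (1 - ?S n s) = g n s" for n s
  proof (cases "\<exists>z<s. bad n z")
    case True
    then have "?S n s \<noteq> 0" by auto
    then have "1 - ?S n s = 0" by linarith
    then have "a + (pair_fst n - a) * (1 - ?S n s) = a" by simp
    then show ?thesis using True by (simp only: g_def if_True)
  next
    case False
    then have "?S n s = 0" by simp
    then show ?thesis using False by (auto simp: g_def)
  qed
  ultimately have comp: "computable2 g"
    unfolding computable2_iff_computes by simp
  have lim: "(\<lambda>s. g n s) \<longlonglongrightarrow> h n" for n
  proof -
    have "\<exists>N. \<forall>s\<ge>N. g n s = h n"
    proof (cases "\<exists>z. bad n z")
      case True
      then obtain z where z: "bad n z" by blast
      then have "g n s = h n" if "s \<ge> Suc z" for s
        using that unfolding g_def h_def by (metis Suc_le_lessD)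
      then show ?thesis by blast
    next
      case False
      then show ?thesis by (auto simp: g_def h_def)
    qed
    then show ?thesis
      by (intro tendsto_eventually) (auto simp: eventually_sequentially)
  qed
  have mono: "g n (s + 1) \<le> g n s" for n s
    unfolding g_def by (auto simp: less_Suc_eq)
  \<comment> \<open>Stage \<open>s + 1\<close> tests one more number than stage \<open>s\<close>,
    namely \<open>s\<close>, so a change at \<open>s\<close> makes \<open>s\<close> the first
    refutation. Without refutations the left side is empty and the value of \<open>LEAST\<close> is
    irrelevant.\<close>
  have change: "{s. g n s \<noteq> g n (s + 1)} \<subseteq> {LEAST z. bad n z}" for n
  proof
    fix s
    assume "s \<in> {s. g n s \<noteq> g n (s + 1)}"
    then have "bad n s" and "\<forall>z<s. \<not> bad n z"
      unfolding g_def by (auto simp: less_Suc_eq split: if_splits)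
    then show "s \<in> {LEAST z. bad n z}"
      by (metis Least_equality not_le singletonI)
  qed
  have "finite {s. g n s \<noteq> g n (s + 1)} \<and> card {s. g n s \<noteq> g n (s + 1)} \<le> 1" for n
    using finite_subset[OF change] card_mono[OF _ change] by simp
  then have "approximable_from_above 1 h"
    unfolding approximable_from_above_def approximates_def
    using comp lim mono by blast
  moreover have "range h = A"
  proof (intro equalityI subsetI)
    fix x
    assume "x \<in> range h"
    then obtain n where n: "x = h n" by blast
    show "x \<in> A"
    proof (cases "\<exists>z. bad n z")
      case True
      then show ?thesis using n a by (simp add: h_def)
    next
      case False
      then have "pair_fst n \<in> A"
        unfolding A bad_def by blast
      \<comment> \<open>Here \<open>a\<close> is at most \<open>pair_fst n\<close>, so the truncated
        expression equals \<open>pair_fst n\<close>.\<close>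
      then show ?thesis
        using n False a_least by (simp add: h_def)
    qed
  next
    fix x
    assume x: "x \<in> A"
    then obtain y where "\<forall>z. R x y z"
      unfolding A by blast
    moreover obtain n where "pair_fst n = x" and "pair_snd n = y"
      by (rule pair_surj)
    ultimately have "h n = x"
      using a_least[OF x] by (simp add: h_def bad_def)
    then show "x \<in> range h" by blast
  qed
  ultimately show ?thesis
    by (rule that)
qed

lemma approximable_from_above_mono:
  "approximable_from_above m f \<Longrightarrow> m \<le> n \<Longrightarrow> approximable_from_above n f"
  unfolding approximable_from_above_def by (meson order_trans)

theorem theorem3p5:
  "(\<forall>f. approximable f \<longrightarrow>
        (\<exists>h. approximable_from_above 2 h \<and> range h = range f)) \<and>
   {range f | f. approximable_from_above 2 f} = {A. A \<noteq> {} \<and> Sigma02 A}"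
proof -
  \<comment> \<open>With \<open>A\<close> the range of an approximable function this gives the first
    claim; with arbitrary \<open>A\<close> it gives one inclusion of the second.\<close>
  have above: "\<exists>h. approximable_from_above 2 h \<and> range h = A"
    if A: "Sigma02 A" "A \<noteq> {}" for A
  proof -
    obtain h where "approximable_from_above 1 h" and "range h = A"
      using A by (rule Sigma02_is_range)
    then show ?thesis
      using approximable_from_above_mono[of 1 h 2] by auto
  qed
  have "approximable f" if "approximable_from_above 2 f" for f
    using that unfolding approximable_from_above_def approximable_def by blast
  then show ?thesis
    using above Sigma02_range by blast
qed

end
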